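(* Let $\mathfrak{A}$ be a residuated lattice. The following assertions are equivalent: (1) $\mathfrak{A}$ is Gelfand; (2) any two distinct maximal filters of $\mathfrak{A}$ can be separated in $Spec_{h}(\mathfrak{A})$, i.e. they have disjoint open neighbourhoods in $Spec_{h}(\mathfrak{A})$; (3) for any maximal filter $\mathfrak{m}$ of $\mathfrak{A}$, the set $\mathscr{G}(\mathfrak{m})$ is closed in $Spec_{h}(\mathfrak{A})$.
   Context: A residuated lattice is an algebra $\mathfrak{A}=(A;\vee,\wedge,\odot,\rightarrow,0,1)$ such that $(A;\vee,\wedge,0,1)$ is a bounded lattice, $(A;\odot,1)$ is a commutative monoid, and $x\odot y\le z$ iff $x\le y\rightarrow z$ for all $x,y,z\in A$. A filter of $\mathfrak{A}$ is a non-empty subset $F\subseteq A$ such that $x,y\in F$ implies $x\odot y\in F$, and $x\in F$, $y\in A$ imply $x\vee y\in F$. A filter is proper if it is not $A$; a maximal filter is a maximal element (under inclusion) among proper filters; a prime filter is a proper filter $\mathfrak{p}$ such that $x\vee y\in\mathfrak{p}$ implies $x\in\mathfrak{p}$ or $y\in\mathfrak{p}$. $Spec(\mathfrak{A})$ is the set of prime filters; every maximal filter is prime. $\mathfrak{A}$ is Gelfand if every prime filter is contained in a unique maximal filter. $Spec_h(\mathfrak{A})$ is $Spec(\mathfrak{A})$ with the hull-kernel topology, whose closed basis is $\{h(x)\mid x\in A\}$, where $h(x)=\{\mathfrak{p}\in Spec(\mathfrak{A})\mid x\in\mathfrak{p}\}$. For a prime filter $\mathfrak{p}$, $\mathscr{G}(\mathfrak{p})=\{\mathfrak{q}\in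 Spec(\mathfrak{A})\mid \mathfrak{q}\subseteq\mathfrak{p}\}$. *)

theory Defs
  imports "HOL-Analysis.Abstract_Topology"
begin

text \<open>The carrier is the whole type; the bounds \<open>0\<close> and \<open>1\<close> are \<open>bot\<close> and \<open>top\<close>.
  The one-element algebra is allowed.\<close>

class residuated_lattice = bounded_lattice +
  fixes odot :: "'a \<Rightarrow> 'a \<Rightarrow> 'a"  (infixl "\<odot>" 70)
    and rimp :: "'a \<Rightarrow> 'a \<Rightarrow> 'a"  (infixr "\<rightarrow>" 60)
  assumes odot_assoc: "(x \<odot> y) \<odot> z = x \<odot> (y \<odot> z)"
    and odot_commute: "x \<odot> y = y \<odot> x"
    and odot_top: "x \<odot> top = x"
    and residuation: "x \<odot> y \<le> z \<longleftrightarrow> x \<le> y \<rightarrow> z"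

definition rl_filter :: "'a::residuated_lattice set \<Rightarrow> bool" where
  "rl_filter F \<longleftrightarrow> F \<noteq> {} \<and> (\<forall>x\<in>F. \<forall>y\<in>F. x \<odot> y \<in> F) \<and> (\<forall>x\<in>F. \<forall>y. sup x y \<in> F)"

definition proper_filter :: "'a::residuated_lattice set \<Rightarrow> bool" where
  "proper_filter F \<longleftrightarrow> rl_filter F \<and> F \<noteq> UNIV"

definition maximal_filter :: "'a::residuated_lattice set \<Rightarrow> bool" where
  "maximal_filter M \<longleftrightarrow> proper_filter M \<and> (\<forall>F. proper_filter F \<longrightarrow> M \<subseteq> F \<longrightarrow> F = M)"

definition prime_filter :: "'a::residuated_lattice set \<Rightarrow> bool" where
  "prime_filter P \<longleftrightarrow> proper_filter P \<and> (\<forall>x y. sup x y \<in> P \<longrightarrow> x \<in> P \<or> y \<in> P)"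

definition Spec :: "'a::residuated_lattice set set" where
  "Spec = {P. prime_filter P}"

definition Gelfand :: "'a::residuated_lattice itself \<Rightarrow> bool" where
  "Gelfand _ \<longleftrightarrow> (\<forall>P\<in>(Spec :: 'a set set). \<exists>!M. maximal_filter M \<and> P \<subseteq> M)"

definition hull_of :: "'a::residuated_lattice \<Rightarrow> 'a set set" where
  "hull_of x = {P \<in> Spec. x \<in> P}"

text \<open>The sets \<open>hull_of x\<close> are a closed basis: the open sets are the unions of their
  complements in \<open>Spec\<close>. The lemmas below confirm that this is a topology on \<open>Spec\<close>.\<close>

definition Spec_h :: "'a::residuated_lattice set topology" where
  "Spec_h = topology (arbitrary union_of (\<lambda>U. \<exists>x. U = Spec - hull_of x))"

definition generizations :: "'a::residuated_lattice set \<Rightarrow> 'a set set" where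
  "generizations P = {Q \<in> Spec. Q \<subseteq> P}"

lemma prime_filter_sup_iff:
  assumes "prime_filter P"
  shows "sup x y \<in> P \<longleftrightarrow> x \<in> P \<or> y \<in> P"
  using assms sup_commute[of x y]
  unfolding prime_filter_def proper_filter_def rl_filter_def by metis

lemma hull_of_sup: "hull_of (sup x y) = hull_of x \<union> hull_of y"
  by (auto simp: hull_of_def Spec_def prime_filter_sup_iff)

lemma hull_of_bot: "hull_of (bot :: 'a::residuated_lattice) = {}"
proof -
  have "P = UNIV" if "bot \<in> P" "rl_filter P" for P :: "'a set"
    using that unfolding rl_filter_def by (metis UNIV_eq_I sup_bot_left)
  then show ?thesis
    by (auto simp: hull_of_def Spec_def prime_filter_def proper_filter_def)
qed

lemma openin_Spec_h:
  "openin Spec_h = arbitrary union_of (\<lambda>U. \<exists>x. U = Spec - hull_of x)"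
proof -
  have "istopology (arbitrary union_of (\<lambda>U. \<exists>x::'a. U = Spec - hull_of x))"
  proof (rule istopology_base)
    fix S T :: "'a set set"
    assume "\<exists>x. S = Spec - hull_of x" "\<exists>x. T = Spec - hull_of x"
    then obtain x y where "S = Spec - hull_of x" "T = Spec - hull_of y" by blast
    then have "S \<inter> T = Spec - hull_of (sup x y)"
      by (auto simp: hull_of_sup)
    then show "\<exists>x. S \<inter> T = Spec - hull_of x" by blast
  qed
  then show ?thesis
    unfolding Spec_h_def by (rule topology_inverse')
qed

lemma topspace_Spec_h: "topspace Spec_h = (Spec :: 'a::residuated_lattice set set)"
proof
  show "topspace Spec_h \<subseteq> (Spec :: 'a set set)"
    unfolding topspace_def openin_Spec_h union_of_def by auto
  have "openin Spec_h (Spec - hull_of (bot :: 'a))"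
    unfolding openin_Spec_h by (intro arbitrary_union_of_inc exI) (rule refl)
  then show "Spec \<subseteq> topspace (Spec_h :: 'a set topology)"
    by (simp add: hull_of_bot openin_subset)
qed

end

theory Submission
  imports Defs
begin

text \<open>
  Basic open sets of the hull-kernel topology have the form \<open>{P. x \<notin> P}\<close>. Hence every open set
  is closed under passing to smaller prime filters, and every closed set under passing to larger
  ones. This makes both topological conditions imply uniqueness of the maximal filter above a
  prime \<open>P\<close>: if \<open>P\<close> lies below the maximal filters \<open>M\<close> and \<open>N\<close>, then \<open>P\<close> belongs to every
  neighbourhood of \<open>M\<close> and of \<open>N\<close>, so these cannot be separated; and if \<open>generizations M\<close> is
  closed, then it contains \<open>P\<close>, hence also \<open>N\<close>, so \<open>N \<subseteq> M\<close>.

  The converse directions rest on an algebraic form of separation: in a Gelfand algebra, distinct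
  maximal filters \<open>M\<close> and \<open>N\<close> admit \<open>x \<notin> M\<close> and \<open>y \<notin> N\<close> with \<open>sup x y = top\<close>
  (\<open>Gelfand_separating_elements\<close>). Otherwise the joins \<open>sup x y\<close> with \<open>x \<notin> M\<close> and \<open>y \<notin> N\<close> would
  form a join-closed set that misses the filter \<open>{top}\<close>, and the prime filter theorem
  (\<open>prime_filter_avoiding\<close>) would give a prime filter below both \<open>M\<close> and \<open>N\<close>. Every prime
  filter contains \<open>x\<close> or \<open>y\<close>, so the primes omitting \<open>x\<close> and the primes omitting \<open>y\<close> are disjoint
  neighbourhoods of \<open>M\<close> and \<open>N\<close>. Moreover, a prime \<open>Q\<close> outside \<open>generizations M\<close> lies below some
  maximal \<open>N \<noteq> M\<close>, and the primes omitting \<open>y\<close> then form a neighbourhood of \<open>Q\<close> that misses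
  \<open>generizations M\<close>.
\<close>

section \<open>Multiplication and joins\<close>

lemma odot_mono_left:
  fixes x y z :: "'a::residuated_lattice"
  assumes "x \<le> y"
  shows "x \<odot> z \<le> y \<odot> z"
proof -
  have "y \<le> z \<rightarrow> y \<odot> z"
    by (simp flip: residuation)
  then show ?thesis
    unfolding residuation using assms by (rule order.trans[rotated])
qed

lemma odot_le_left: "x \<odot> y \<le> (x :: 'a::residuated_lattice)"
  using odot_mono_left[of y top x] by (metis odot_commute odot_top top_greatest)

text \<open>As the left adjoint of a residual, multiplication preserves joins.\<close>

lemma odot_sup_distrib_left:
  fixes x y z :: "'a::residuated_lattice"
  shows "sup x y \<odot> z = sup (x \<odot> z) (y \<odot> z)"
proof (rule order.antisym)
  show "sup x y \<odot> z \<le> sup (x \<odot> z) (y \<odot> z)"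
    unfolding residuation by (rule sup.boundedI) (simp_all flip: residuation)
  show "sup (x \<odot> z) (y \<odot> z) \<le> sup x y \<odot> z"
    by (simp add: odot_mono_left)
qed

text \<open>Expanding the product gives \<open>x \<odot> y\<close> and three terms with a factor \<open>b\<close>, which lie below
  \<open>b\<close>.\<close>

lemma sup_odot_sup_le:
  fixes x y b :: "'a::residuated_lattice"
  shows "sup x b \<odot> sup y b \<le> sup (x \<odot> y) b"
proof -
  have "x \<odot> sup y b = sup (y \<odot> x) (b \<odot> x)"
    by (simp add: odot_commute[of x] odot_sup_distrib_left)
  also have "\<dots> \<le> sup (x \<odot> y) b"
    by (metis odot_commute odot_le_left sup.mono order.refl)
  finally have "x \<odot> sup y b \<le> sup (x \<odot> y) b" .
  moreover have "b \<odot> sup y b \<le> sup (x \<odot> y) b"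
    by (rule order.trans[OF odot_le_left]) simp
  ultimately show ?thesis
    by (simp add: odot_sup_distrib_left)
qed

section \<open>Filters\<close>

lemma rl_filter_upward:
  assumes "rl_filter F" "x \<in> F" "x \<le> y"
  shows "y \<in> F"
  using assms unfolding rl_filter_def by (metis sup.absorb2)

lemma top_in_rl_filter: "rl_filter F \<Longrightarrow> top \<in> F"
  unfolding rl_filter_def by (metis ex_in_conv sup_top_right)

lemma rl_filter_top: "rl_filter {top :: 'a::residuated_lattice}"
  by (simp add: rl_filter_def odot_top)

lemma proper_filter_iff: "proper_filter F \<longleftrightarrow> rl_filter F \<and> bot \<notin> F"
  unfolding proper_filter_def using rl_filter_upward[of F bot] by auto

text \<open>Adjoining \<open>a\<close> to \<open>F\<close> by products \<open>p \<odot> a \<odot> \<dots> \<odot> a\<close> would bring in powers. This filter also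
  contains \<open>F\<close>, and it contains every \<open>a\<close> with \<open>sup a b \<in> F\<close>, which suffices for deducing
  primeness from maximality.\<close>

lemma rl_filter_sup_vimage:
  assumes F: "rl_filter F"
  shows "rl_filter {z. sup z b \<in> F}"
  unfolding rl_filter_def
proof (intro conjI ballI allI)
  show "{z. sup z b \<in> F} \<noteq> {}"
    using top_in_rl_filter[OF F] by (auto intro: exI[of _ top])
next
  fix x y assume "x \<in> {z. sup z b \<in> F}" "y \<in> {z. sup z b \<in> F}"
  then have "sup x b \<odot> sup y b \<in> F"
    using F unfolding rl_filter_def by simp
  then show "x \<odot> y \<in> {z. sup z b \<in> F}"
    using rl_filter_upward[OF F _ sup_odot_sup_le] by simp
next
  fix x y assume "x \<in> {z. sup z b \<in> F}"
  then have "sup x b \<in> F" by simp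
  moreover have "sup x b \<le> sup (sup x y) b"
    by (intro sup.mono) simp_all
  ultimately have "sup (sup x y) b \<in> F"
    using rl_filter_upward[OF F] by blast
  then show "sup x y \<in> {z. sup z b \<in> F}" by simp
qed

section \<open>The prime filter theorem\<close>

lemma ex_maximal_filter_avoiding:
  assumes F: "rl_filter F" "F \<inter> S = {}"
  obtains P where "rl_filter P" "P \<inter> S = {}" "F \<subseteq> P"
    "\<And>G. \<lbrakk>rl_filter G; G \<inter> S = {}; P \<subseteq> G\<rbrakk> \<Longrightarrow> G = P"
proof -
  let ?A = "{G. rl_filter G \<and> G \<inter> S = {} \<and> F \<subseteq> G}"
  have "\<exists>P\<in>?A. \<forall>G\<in>?A. P \<subseteq> G \<longrightarrow> G = P"
  proof (rule subset_Zorn_nonempty)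
    show "?A \<noteq> {}" using F by blast
  next
    fix C assume "C \<noteq> {}" and chain: "subset.chain ?A C"
    then have C: "rl_filter G" "G \<inter> S = {}" "F \<subseteq> G" if "G \<in> C" for G
      using that by (auto simp: subset.chain_def)
    have "rl_filter (\<Union>C)"
      unfolding rl_filter_def
    proof (intro conjI ballI allI)
      show "\<Union>C \<noteq> {}"
        using \<open>C \<noteq> {}\<close> C(1) top_in_rl_filter by blast
    next
      fix x y assume "x \<in> \<Union>C" "y \<in> \<Union>C"
      then obtain G H where GH: "G \<in> C" "x \<in> G" "H \<in> C" "y \<in> H"
        by blast
      then have "G \<subseteq> H \<or> H \<subseteq> G"
        using chain by (simp add: subset_chain_def)
      then obtain K where "K \<in> C" "x \<in> K" "y \<in> K"
        using GH by blast
      then show "x \<odot> y \<in> \<Union>C"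
        using C(1) unfolding rl_filter_def by blast
    next
      fix x y assume "x \<in> \<Union>C"
      then show "sup x y \<in> \<Union>C"
        using C(1) unfolding rl_filter_def by blast
    qed
    then show "\<Union>C \<in> ?A"
      using \<open>C \<noteq> {}\<close> C(2,3) by blast
  qed
  then obtain P where P: "P \<in> ?A" and "\<forall>G\<in>?A. P \<subseteq> G \<longrightarrow> G = P"
    by blast
  then have "G = P" if "rl_filter G" "G \<inter> S = {}" "P \<subseteq> G" for G
    using that by blast
  then show thesis
    using that P by blast
qed

text \<open>If \<open>sup a b \<in> P\<close> while \<open>a\<close> and \<open>b\<close> are outside \<open>P\<close>, then two successive proper enlargements of
  \<open>P\<close> must meet \<open>S\<close>: the first one replaces \<open>a\<close> by some \<open>s \<in> S\<close>, the second one replaces \<open>b\<close> by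
  some \<open>t \<in> S\<close>, each time keeping the join in \<open>P\<close>.\<close>

lemma prime_if_maximal_avoiding:
  assumes P: "rl_filter P" "P \<inter> S = {}"
    and maximal: "\<And>G. \<lbrakk>rl_filter G; G \<inter> S = {}; P \<subseteq> G\<rbrakk> \<Longrightarrow> G = P"
    and "S \<noteq> {}" and S: "\<And>s t. \<lbrakk>s \<in> S; t \<in> S\<rbrakk> \<Longrightarrow> sup s t \<in> S"
  shows "prime_filter P"
proof -
  have swap: "\<exists>s\<in>S. sup s b \<in> P" if "sup a b \<in> P" "a \<notin> P" for a b
  proof (rule ccontr)
    let ?G = "{z. sup z b \<in> P}"
    assume "\<not> ?thesis"
    moreover have "P \<subseteq> ?G"
      using P(1) unfolding rl_filter_def by blast
    ultimately have "?G = P"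
      using maximal[OF rl_filter_sup_vimage[OF P(1)]] by blast
    then show False using that by blast
  qed
  have "a \<in> P \<or> b \<in> P" if "sup a b \<in> P" for a b
  proof (rule ccontr)
    assume ab: "\<not> (a \<in> P \<or> b \<in> P)"
    then obtain s where s: "s \<in> S" "sup b s \<in> P"
      using swap \<open>sup a b \<in> P\<close> by (metis sup_commute)
    then obtain t where "t \<in> S" "sup t s \<in> P"
      using swap ab by blast
    then show False using S s(1) P(2) by blast
  qed
  moreover have "proper_filter P"
    using P \<open>S \<noteq> {}\<close> unfolding proper_filter_def by blast
  ultimately show ?thesis
    unfolding prime_filter_def by blast
qed

lemma prime_filter_avoiding:
  assumes "rl_filter F" "F \<inter> S = {}" "S \<noteq> {}"
    and "\<And>s t. \<lbrakk>s \<in> S; t \<in> S\<rbrakk> \<Longrightarrow> sup s t \<in> S"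
  obtains P where "prime_filter P" "F \<subseteq> P" "P \<inter> S = {}"
proof (rule ex_maximal_filter_avoiding[OF assms(1,2)])
  fix P
  assume P: "rl_filter P" "P \<inter> S = {}" "F \<subseteq> P"
    "\<And>G. \<lbrakk>rl_filter G; G \<inter> S = {}; P \<subseteq> G\<rbrakk> \<Longrightarrow> G = P"
  have "prime_filter P"
    by (rule prime_if_maximal_avoiding[OF P(1,2,4) assms(3,4)])
  then show thesis
    using that P(2,3) by blast
qed

section \<open>Maximal filters and the Gelfand property\<close>

text \<open>Taking \<open>S = {bot}\<close> in the results on filters that avoid a join-closed set \<open>S\<close> turns them into
  primeness and existence of maximal filters.\<close>

lemma maximal_filter_iff_avoiding_bot:
  "maximal_filter M \<longleftrightarrow> rl_filter M \<and> M \<inter> {bot} = {} \<and>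
     (\<forall>G. rl_filter G \<longrightarrow> G \<inter> {bot} = {} \<longrightarrow> M \<subseteq> G \<longrightarrow> G = M)"
  unfolding maximal_filter_def proper_filter_iff by auto

lemma maximal_filter_in_Spec: "maximal_filter M \<Longrightarrow> M \<in> Spec"
  unfolding maximal_filter_iff_avoiding_bot Spec_def
  using prime_if_maximal_avoiding[of M "{bot}"] by simp

lemma ex_maximal_filter_above:
  assumes "P \<in> Spec"
  obtains M where "maximal_filter M" "P \<subseteq> M"
proof -
  have "rl_filter P" "P \<inter> {bot} = {}"
    using assms by (auto simp: Spec_def prime_filter_def proper_filter_iff)
  then obtain M where "rl_filter M" "M \<inter> {bot} = {}" "P \<subseteq> M"
    "\<And>G. \<lbrakk>rl_filter G; G \<inter> {bot} = {}; M \<subseteq> G\<rbrakk> \<Longrightarrow> G = M"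
    by (rule ex_maximal_filter_avoiding) blast
  then show thesis
    using that unfolding maximal_filter_iff_avoiding_bot by blast
qed

lemma Gelfand_iff:
  "Gelfand TYPE('a::residuated_lattice) \<longleftrightarrow>
     (\<forall>P M N :: 'a set. P \<in> Spec \<longrightarrow> maximal_filter M \<longrightarrow> maximal_filter N \<longrightarrow>
        P \<subseteq> M \<longrightarrow> P \<subseteq> N \<longrightarrow> M = N)"
proof -
  have "(\<exists>!M. maximal_filter M \<and> P \<subseteq> M) \<longleftrightarrow>
      (\<forall>M N. maximal_filter M \<longrightarrow> maximal_filter N \<longrightarrow> P \<subseteq> M \<longrightarrow> P \<subseteq> N \<longrightarrow> M = N)"
    if P: "P \<in> Spec" for P :: "'a set"
  proof -
    obtain M where "maximal_filter M" "P \<subseteq> M"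
      using ex_maximal_filter_above[OF P] .
    then show ?thesis by auto
  qed
  then show ?thesis
    unfolding Gelfand_def by (simp add: Ball_def)
qed

section \<open>Order and hull-kernel topology\<close>

lemma openin_Spec_h_omitting: "openin Spec_h (Spec - hull_of x)"
  unfolding openin_Spec_h by (intro arbitrary_union_of_inc exI) (rule refl)

lemma openin_Spec_h_iff:
  "openin Spec_h U \<longleftrightarrow>
     U \<subseteq> Spec \<and> (\<forall>P\<in>U. \<exists>x. x \<notin> P \<and> Spec - hull_of x \<subseteq> U)"
proof
  assume U: "openin Spec_h U"
  have "\<exists>x. x \<notin> P \<and> Spec - hull_of x \<subseteq> U" if "P \<in> U" for P
    using U that unfolding openin_Spec_h arbitrary_union_of_alt hull_of_def by blast
  then show "U \<subseteq> Spec \<and> (\<forall>P\<in>U. \<exists>x. x \<notin> P \<and> Spec - hull_of x \<subseteq> U)"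
    using openin_subset[OF U] by (simp add: topspace_Spec_h)
next
  assume U: "U \<subseteq> Spec \<and> (\<forall>P\<in>U. \<exists>x. x \<notin> P \<and> Spec - hull_of x \<subseteq> U)"
  show "openin Spec_h U"
  proof (subst openin_subopen, rule ballI)
    fix P assume "P \<in> U"
    then obtain x where "x \<notin> P" "Spec - hull_of x \<subseteq> U" "P \<in> Spec"
      using U by blast
    then show "\<exists>T. openin Spec_h T \<and> P \<in> T \<and> T \<subseteq> U"
      using openin_Spec_h_omitting[of x] by (auto simp: hull_of_def)
  qed
qed

lemma openin_Spec_h_downward:
  assumes "openin Spec_h U" "Q \<in> U" "P \<in> Spec" "P \<subseteq> Q"
  shows "P \<in> U"
  using assms unfolding openin_Spec_h_iff hull_of_def by blast

lemma closedin_Spec_h_upward: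
  assumes "closedin Spec_h C" "P \<in> C" "Q \<in> Spec" "P \<subseteq> Q"
  shows "Q \<in> C"
  using assms openin_Spec_h_downward[of "Spec - C" Q P]
  by (auto simp: closedin_def topspace_Spec_h)

section \<open>Separation in Gelfand algebras\<close>

text \<open>A prime filter that contains no join \<open>sup x y\<close> with \<open>x \<notin> M\<close> and \<open>y \<notin> N\<close> is below both \<open>M\<close> and
  \<open>N\<close>, so in a Gelfand algebra no such prime exists.\<close>

lemma Gelfand_separating_elements:
  fixes M N :: "'a::residuated_lattice set"
  assumes "Gelfand TYPE('a)" and M: "maximal_filter M" and N: "maximal_filter N" and "M \<noteq> N"
  obtains x y where "x \<notin> M" "y \<notin> N" "sup x y = top"
proof -
  define S where "S = {sup x y | x y. x \<notin> M \<and> y \<notin> N}"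
  have prime: "prime_filter M" "prime_filter N"
    using maximal_filter_in_Spec M N by (auto simp: Spec_def)
  have bot: "bot \<notin> M" "bot \<notin> N"
    using M N by (auto simp: maximal_filter_def proper_filter_iff)
  have "top \<in> S"
  proof (rule ccontr)
    assume "top \<notin> S"
    have "sup s t \<in> S" if st: "s \<in> S" "t \<in> S" for s t
    proof -
      obtain x y x' y' where xy: "s = sup x y" "t = sup x' y'"
        "x \<notin> M" "y \<notin> N" "x' \<notin> M" "y' \<notin> N"
        using st unfolding S_def by blast
      then have "sup x x' \<notin> M" "sup y y' \<notin> N"
        by (simp_all add: prime prime_filter_sup_iff)
      moreover have "sup s t = sup (sup x x') (sup y y')"
        by (simp add: xy sup_assoc sup_left_commute)
      ultimately show ?thesis
        unfolding S_def by blast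
    qed
    moreover have "{top} \<inter> S = {}" "S \<noteq> {}"
      using \<open>top \<notin> S\<close> bot unfolding S_def by blast+
    ultimately obtain P where P: "prime_filter P" "P \<inter> S = {}"
      using prime_filter_avoiding[OF rl_filter_top] by metis
    \<comment> \<open>An element of \<open>P\<close> outside \<open>M\<close> or \<open>N\<close> would be its own join with \<open>bot\<close>, hence in \<open>S\<close>.\<close>
    have "P \<subseteq> M"
    proof
      fix x assume "x \<in> P"
      moreover have "sup x bot \<in> S" if "x \<notin> M"
        using that bot unfolding S_def by blast
      ultimately show "x \<in> M" using P(2) by auto
    qed
    moreover have "P \<subseteq> N"
    proof
      fix y assume "y \<in> P"
      moreover have "sup bot y \<in> S" if "y \<notin> N"
        using that bot unfolding S_def by blast
      ultimately show "y \<in> N" using P(2) by auto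
    qed
    ultimately have "M = N"
      using assms(1) P(1) M N unfolding Gelfand_iff Spec_def by blast
    with \<open>M \<noteq> N\<close> show False ..
  qed
  then show thesis
    using that unfolding S_def by auto
qed

lemma Spec_contains_of_sup_top:
  assumes "P \<in> Spec" "sup x y = top"
  shows "x \<in> P \<or> y \<in> P"
proof -
  have "prime_filter P" "top \<in> P"
    using assms(1) top_in_rl_filter by (auto simp: Spec_def prime_filter_def proper_filter_def)
  then show ?thesis
    using prime_filter_sup_iff[of P x y] assms(2) by simp
qed

lemma Gelfand_imp_separated:
  fixes M N :: "'a::residuated_lattice set"
  assumes "Gelfand TYPE('a)" "maximal_filter M" "maximal_filter N" "M \<noteq> N"
  shows "\<exists>U V. openin Spec_h U \<and> openin Spec_h V \<and> M \<in> U \<and> N \<in> V \<and> U \<inter> V = {}"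
proof -
  obtain x y where xy: "x \<notin> M" "y \<notin> N" "sup x y = top"
    using Gelfand_separating_elements[OF assms] .
  have "M \<in> Spec - hull_of x" "N \<in> Spec - hull_of y"
    using xy assms(2,3) by (auto simp: hull_of_def maximal_filter_in_Spec)
  moreover have "(Spec - hull_of x) \<inter> (Spec - hull_of y) = {}"
    using Spec_contains_of_sup_top[OF _ xy(3)] by (auto simp: hull_of_def)
  ultimately show ?thesis
    using openin_Spec_h_omitting by blast
qed

lemma Gelfand_imp_closedin_generizations:
  fixes M :: "'a::residuated_lattice set"
  assumes G: "Gelfand TYPE('a)" and M: "maximal_filter M"
  shows "closedin Spec_h (generizations M)"
proof -
  have "\<exists>y. y \<notin> Q \<and> Spec - hull_of y \<subseteq> Spec - generizations M"
    if "Q \<in> Spec - generizations M" for Q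
  proof -
    have Q: "Q \<in> Spec" "\<not> Q \<subseteq> M"
      using that by (auto simp: generizations_def)
    then obtain N where N: "maximal_filter N" "Q \<subseteq> N"
      using ex_maximal_filter_above by blast
    then have "M \<noteq> N" using Q(2) by blast
    then obtain x y where xy: "x \<notin> M" "y \<notin> N" "sup x y = top"
      using Gelfand_separating_elements[OF G M N(1)] by blast
    then have "Spec - hull_of y \<subseteq> Spec - generizations M"
      using Spec_contains_of_sup_top[OF _ xy(3)]
      by (auto simp: hull_of_def generizations_def)
    then show ?thesis using xy(2) N(2) by blast
  qed
  then show ?thesis
    unfolding closedin_def topspace_Spec_h openin_Spec_h_iff
    by (auto simp: generizations_def)
qed

section \<open>Topological criteria for the Gelfand property\<close>

lemma separated_imp_Gelfand:
  assumes "\<And>M N :: 'a::residuated_lattice set.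
      \<lbrakk>maximal_filter M; maximal_filter N; M \<noteq> N\<rbrakk> \<Longrightarrow>
      \<exists>U V. openin Spec_h U \<and> openin Spec_h V \<and> M \<in> U \<and> N \<in> V \<and> U \<inter> V = {}"
  shows "Gelfand TYPE('a)"
  unfolding Gelfand_iff
proof (intro allI impI)
  fix P M N :: "'a set"
  assume P: "P \<in> Spec" "P \<subseteq> M" "P \<subseteq> N" and "maximal_filter M" "maximal_filter N"
  show "M = N"
  proof (rule ccontr)
    assume "M \<noteq> N"
    then obtain U V where UV: "openin Spec_h U" "openin Spec_h V" "M \<in> U" "N \<in> V" "U \<inter> V = {}"
      using assms[OF \<open>maximal_filter M\<close> \<open>maximal_filter N\<close>] by blast
    have "P \<in> U" "P \<in> V"
      using openin_Spec_h_downward[OF UV(1,3) P(1,2)]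
        openin_Spec_h_downward[OF UV(2,4) P(1,3)] by simp_all
    then show False using UV(5) by blast
  qed
qed

lemma closedin_generizations_imp_Gelfand:
  assumes closed: "\<And>M :: 'a::residuated_lattice set.
      maximal_filter M \<Longrightarrow> closedin Spec_h (generizations M)"
  shows "Gelfand TYPE('a)"
  unfolding Gelfand_iff
proof (intro allI impI)
  fix P M N :: "'a set"
  assume P: "P \<in> Spec" "P \<subseteq> M" "P \<subseteq> N" and M: "maximal_filter M" and N: "maximal_filter N"
  have "P \<in> generizations M"
    using P by (simp add: generizations_def)
  then have "N \<in> generizations M"
    using closedin_Spec_h_upward[OF closed[OF M]] maximal_filter_in_Spec[OF N] P(3) by blast
  then have "N \<subseteq> M"
    by (simp add: generizations_def)
  then show "M = N"
    using M N unfolding maximal_filter_def by blast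
qed

theorem theorem3p8:
  shows
    "(Gelfand TYPE('a::residuated_lattice) \<longleftrightarrow>
       (\<forall>M N :: 'a set. maximal_filter M \<and> maximal_filter N \<and> M \<noteq> N \<longrightarrow>
          (\<exists>U V. openin Spec_h U \<and> openin Spec_h V \<and> M \<in> U \<and> N \<in> V \<and> U \<inter> V = {}))) \<and>
     (Gelfand TYPE('a) \<longleftrightarrow>
       (\<forall>M :: 'a set. maximal_filter M \<longrightarrow> closedin Spec_h (generizations M)))"
proof (intro conjI iffI allI impI, goal_cases)
  case (1 M N)
  then show ?case using Gelfand_imp_separated by blast
next
  case 2
  then show ?case by (intro separated_imp_Gelfand) simp
next
  case (3 M)
  then show ?case by (rule Gelfand_imp_closedin_generizations)
next
  case 4
  then show ?case by (intro closedin_generizations_imp_Gelfand) simp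
qed

end
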